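(* Let $G$ be a graph with a length-function $\ell$ and let $C\subseteq G$ be a cycle. If $C$ is $6$-geodesic in $G$, then $C$ is fully geodesic in $G$.
   Context: All graphs are finite; parallel edges are allowed, loops are not; a cycle may consist of two vertices joined by two parallel edges. A length-function on a graph $G$ is a map $\ell:E(G)\to\mathbb{R}^+$ (strictly positive reals); for a subgraph $H$ put $\ell(H)=\sum_{e\in E(H)}\ell(e)$, and subgraphs carry the restricted length-function. For $A\subseteq V(G)$, the Steiner distance $\mathrm{sd}_G(A)$ is the minimum of $\ell(S)$ over all connected subgraphs $S\subseteq G$ with $A\subseteq V(S)$ ($\infty$ if none exists). A subgraph $H\subseteq G$ is $k$-geodesic in $G$ if $\mathrm{sd}_H(A)=\mathrm{sd}_G(A)$ for every $A\subseteq V(H)$ with $|A|\le k$; it is fully geodesic in $G$ if it is $k$-geodesic for every $k\in\mathbb{N}$. *)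

theory Defs
  imports Complex_Main "HOL-Library.Extended_Real"
begin

text \<open>Multigraphs: a vertex set V, an edge set E, and an incidence map ends assigning
  to each edge its set of two (distinct) endpoints. Parallel edges allowed, loops not.\<close>

definition graph :: "'v set \<Rightarrow> 'e set \<Rightarrow> ('e \<Rightarrow> 'v set) \<Rightarrow> bool" where
  "graph V E ends \<longleftrightarrow> finite V \<and> finite E \<and> (\<forall>e\<in>E. card (ends e) = 2 \<and> ends e \<subseteq> V)"

definition subgraph :: "'v set \<Rightarrow> 'e set \<Rightarrow> 'v set \<Rightarrow> 'e set \<Rightarrow> ('e \<Rightarrow> 'v set) \<Rightarrow> bool" where
  "subgraph V' E' V E ends \<longleftrightarrow> V' \<subseteq> V \<and> E' \<subseteq> E \<and> (\<forall>e\<in>E'. ends e \<subseteq> V')"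

definition adj :: "'e set \<Rightarrow> ('e \<Rightarrow> 'v set) \<Rightarrow> ('v \<times> 'v) set" where
  "adj E ends = {(x, y). \<exists>e\<in>E. ends e = {x, y}}"

definition connected_graph :: "'v set \<Rightarrow> 'e set \<Rightarrow> ('e \<Rightarrow> 'v set) \<Rightarrow> bool" where
  "connected_graph V E ends \<longleftrightarrow> V \<noteq> {} \<and> (\<forall>u\<in>V. \<forall>v\<in>V. (u, v) \<in> (adj E ends)\<^sup>*)"

text \<open>Length of a subgraph: sum of the lengths of its edges.\<close>
definition glen :: "('e \<Rightarrow> real) \<Rightarrow> 'e set \<Rightarrow> real" where
  "glen len E = (\<Sum>e\<in>E. len e)"

text \<open>Steiner distance of A in the graph (V,E): minimum length of a connected subgraph
  containing A (infinity if none). Graphs are finite, so the infimum is a minimum.\<close>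
definition steiner_dist :: "('e \<Rightarrow> 'v set) \<Rightarrow> ('e \<Rightarrow> real) \<Rightarrow> 'v set \<Rightarrow> 'e set \<Rightarrow> 'v set \<Rightarrow> ereal" where
  "steiner_dist ends len V E A =
     Inf {ereal (glen len E') | V' E'. subgraph V' E' V E ends \<and> connected_graph V' E' ends \<and> A \<subseteq> V'}"

definition k_geodesic :: "nat \<Rightarrow> ('e \<Rightarrow> 'v set) \<Rightarrow> ('e \<Rightarrow> real) \<Rightarrow> 'v set \<Rightarrow> 'e set \<Rightarrow> 'v set \<Rightarrow> 'e set \<Rightarrow> bool" where
  "k_geodesic k ends len VH EH V E \<longleftrightarrow>
     (\<forall>A. A \<subseteq> VH \<and> card A \<le> k \<longrightarrow> steiner_dist ends len VH EH A = steiner_dist ends len V E A)"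

definition fully_geodesic :: "('e \<Rightarrow> 'v set) \<Rightarrow> ('e \<Rightarrow> real) \<Rightarrow> 'v set \<Rightarrow> 'e set \<Rightarrow> 'v set \<Rightarrow> 'e set \<Rightarrow> bool" where
  "fully_geodesic ends len VH EH V E \<longleftrightarrow> (\<forall>k. k_geodesic k ends len VH EH V E)"

text \<open>A cycle: distinct vertices v_0..v_(n-1) (n >= 2) and distinct edges e_0..e_(n-1)
  with e_i joining v_i and v_(i+1 mod n); the graph consists exactly of these.\<close>
definition is_cycle :: "('e \<Rightarrow> 'v set) \<Rightarrow> 'v set \<Rightarrow> 'e set \<Rightarrow> bool" where
  "is_cycle ends VC EC \<longleftrightarrow>
     (\<exists>vs es. length vs \<ge> 2 \<and> length es = length vs \<and> distinct vs \<and> distinct es \<and>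
        (\<forall>i<length vs. ends (es ! i) = {vs ! i, vs ! ((i + 1) mod length vs)}) \<and>
        VC = set vs \<and> EC = set es)"

end

theory Submission
  imports Defs
begin

text \<open>
  Let \<open>A\<close> be a smallest set of vertices of the cycle \<open>C\<close> that the graph connects by a tree \<open>T\<close>
  shorter than \<open>sd\<^sub>C A\<close>; then \<open>A\<close> has at least seven elements. Cutting a recursive decomposition
  of \<open>T\<close> at a minimal piece with at least three terminals leaves at most four terminals in the
  piece, hence at least three outside. Branching both sides once more, \<open>T\<close> contains an H-shape: a
  path \<open>P\<close> with two edge-disjoint subtrees attached at either end, which partition \<open>A\<close> into
  \<open>X1, X2\<close> and \<open>Y1, Y2\<close> with \<open>X1 \<union> X2\<close> and \<open>Y1 \<union> Y2\<close> of size at least three.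

  By minimality every proper subset \<open>B\<close> of \<open>A\<close> is optimally connected by an arc \<open>H\<^sub>B\<close> of \<open>C\<close>.
  If \<open>T\<close> splits edge-disjointly into connections of \<open>Z\<close> and of \<open>A - Z\<close>, then \<open>H\<^sub>Z\<close> and
  \<open>H\<^bsub>A-Z\<^esub>\<close> cannot meet, since their union would connect \<open>A\<close> too cheaply. So each of the four
  parts is an interval of the cyclic order, which up to names is \<open>X1, X2, Y1, Y2\<close>. The lengths of
  the arcs for \<open>X1 \<union> X2\<close>, \<open>Y1 \<union> Y2\<close>, \<open>X1 \<union> Y1\<close> and \<open>X2 \<union> Y2\<close> add up to at most twice that
  of \<open>T\<close>, because \<open>P\<close> is unused by the first two and used by both of the last two; whichever way
  round \<open>C\<close> the last two arcs go, this sum is at least \<open>2 sd\<^sub>C A\<close>.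
\<close>

section \<open>Connected subgraphs and rooted trees\<close>

text \<open>The vertex set is quantified away because the length depends on the edges alone.
  \<open>U\<close> need only lie inside it, so a connection may pass through further
  vertices.\<close>

definition spans :: "('e \<Rightarrow> 'v set) \<Rightarrow> 'v set \<Rightarrow> 'e set \<Rightarrow> 'v set \<Rightarrow> 'e set \<Rightarrow> bool" where
  "spans ends V E U F \<longleftrightarrow>
     (\<exists>W. subgraph W F V E ends \<and> connected_graph W F ends \<and> U \<subseteq> W)"

lemma adj_mono: "F \<subseteq> F' \<Longrightarrow> adj F ends \<subseteq> adj F' ends"
  unfolding adj_def by blast

lemma spans_mono: "spans ends V E U F \<Longrightarrow> U' \<subseteq> U \<Longrightarrow> spans ends V E U' F"
  unfolding spans_def by blast

lemma spans_imp_subset: "spans ends V E U F \<Longrightarrow> F \<subseteq> E"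
  unfolding spans_def subgraph_def by blast

lemma spans_supergraph:
  assumes "spans ends V' E' U F" "subgraph V' E' V E ends"
  shows "spans ends V E U F"
proof -
  obtain W where "subgraph W F V' E' ends" "connected_graph W F ends" "U \<subseteq> W"
    using assms(1) unfolding spans_def by blast
  moreover from this(1) have "subgraph W F V E ends"
    using assms(2) unfolding subgraph_def by auto
  ultimately show ?thesis unfolding spans_def by blast
qed

lemma spans_singleton: "v \<in> V \<Longrightarrow> spans ends V E {v} {}"
  unfolding spans_def subgraph_def connected_graph_def by (intro exI[of _ "{v}"]) auto

lemma spans_edge:
  assumes "e \<in> E" "ends e = {u, v}" "u \<in> V" "v \<in> V"
  shows "spans ends V E {u, v} {e}"
proof -
  have "(u, v) \<in> adj {e} ends" "(v, u) \<in> adj {e} ends"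
    using assms by (auto simp: adj_def)
  then have "connected_graph {u, v} {e} ends"
    unfolding connected_graph_def by auto
  then show ?thesis
    using assms unfolding spans_def subgraph_def by (intro exI[of _ "{u, v}"]) auto
qed

lemma spans_union:
  assumes "spans ends V E U F" "spans ends V E U' F'" "x \<in> U" "x \<in> U'"
  shows "spans ends V E (U \<union> U') (F \<union> F')"
proof -
  obtain W where W: "subgraph W F V E ends" "connected_graph W F ends" "U \<subseteq> W"
    using assms(1) unfolding spans_def by blast
  obtain W' where W': "subgraph W' F' V E ends" "connected_graph W' F' ends" "U' \<subseteq> W'"
    using assms(2) unfolding spans_def by blast
  have x: "x \<in> W" "x \<in> W'" using assms W W' by auto
  let ?R = "(adj (F \<union> F') ends)\<^sup>*"
  have sub: "(adj F ends)\<^sup>* \<subseteq> ?R" "(adj F' ends)\<^sup>* \<subseteq> ?R"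
    by (simp_all add: rtrancl_mono adj_mono)
  have "(y, x) \<in> ?R \<and> (x, y) \<in> ?R" if "y \<in> W \<union> W'" for y
    using that W(2) W'(2) x sub unfolding connected_graph_def by blast
  then have "connected_graph (W \<union> W') (F \<union> F') ends"
    unfolding connected_graph_def using x by (blast intro: rtrancl_trans)
  then show ?thesis
    using W W' unfolding spans_def subgraph_def by (intro exI[of _ "W \<union> W'"]) auto
qed

lemma spans_incident:
  assumes "spans ends V E U F" "\<And>x. x \<in> U' \<Longrightarrow> \<exists>e\<in>F. x \<in> ends e"
  shows "spans ends V E (U \<union> U') F"
proof -
  obtain W where W: "subgraph W F V E ends" "connected_graph W F ends" "U \<subseteq> W"
    using assms(1) unfolding spans_def by blast
  then have "U' \<subseteq> W" using assms(2) unfolding subgraph_def by blast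
  then show ?thesis using W unfolding spans_def by blast
qed

text \<open>Only the edge sets of the two joined pieces are required to be disjoint; their vertex sets
  may overlap. Edge-disjointness is all that the length estimates need.\<close>
inductive rtree :: "('e \<Rightarrow> 'v set) \<Rightarrow> 'v set \<Rightarrow> 'e set \<Rightarrow> 'v \<Rightarrow> 'v set \<Rightarrow> 'e set \<Rightarrow> bool"
  for ends V E where
  root: "u \<in> V \<Longrightarrow> rtree ends V E u {u} {}"
| join: "\<lbrakk>rtree ends V E u W F; rtree ends V E u' W' F'; e \<in> E; ends e = {u, u'};
    F \<inter> F' = {}; e \<notin> F; e \<notin> F'\<rbrakk> \<Longrightarrow> rtree ends V E u (W \<union> W') (insert e (F \<union> F'))"

lemma rtree_root: "rtree ends V E u W F \<Longrightarrow> u \<in> W"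
  by (induction rule: rtree.induct) auto

lemma rtree_subset: "rtree ends V E u W F \<Longrightarrow> W \<subseteq> V \<and> F \<subseteq> E \<and> finite F"
  by (induction rule: rtree.induct) auto

lemma rtree_spans: "rtree ends V E u W F \<Longrightarrow> spans ends V E W F"
proof (induction rule: rtree.induct)
  case (root u)
  then show ?case by (rule spans_singleton)
next
  case (join u W F u' W' F' e)
  have u: "u \<in> W" "u' \<in> W'" by (rule rtree_root[OF join.hyps(1)], rule rtree_root[OF join.hyps(2)])
  then have V: "u \<in> V" "u' \<in> V"
    using rtree_subset[OF join.hyps(1)] rtree_subset[OF join.hyps(2)] by auto
  have d: "spans ends V E {u, u'} {e}" using join.hyps(3,4) V by (rule spans_edge)
  have "spans ends V E (W \<union> {u, u'}) (F \<union> {e})"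
    by (rule spans_union[OF join.IH(1) d, of u]) (use u in simp_all)
  from spans_union[OF this join.IH(2), of u']
  have "spans ends V E ((W \<union> {u, u'}) \<union> W') ((F \<union> {e}) \<union> F')"
    using u by simp
  moreover have "(W \<union> {u, u'}) \<union> W' = W \<union> W'" "(F \<union> {e}) \<union> F' = insert e (F \<union> F')"
    using u by auto
  ultimately show ?case by simp
qed

text \<open>Gluing at an arbitrary vertex instead of the root: the recursion descends into a half
  that contains \<open>y\<close>. This is what later allows the remainder of a cut tree to be
  re-rooted at the cut vertex.\<close>

lemma rtree_attach:
  assumes "rtree ends V E u W F" "y \<in> W" "rtree ends V E y' W' F'" "e \<in> E" "ends e = {y, y'}"
    "F \<inter> F' = {}" "e \<notin> F" "e \<notin> F'"
  shows "rtree ends V E u (W \<union> W') (insert e (F \<union> F'))"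
  using assms(1,2,6,7)
proof (induction rule: rtree.induct)
  case (root u)
  then have "rtree ends V E u ({u} \<union> W') (insert e ({} \<union> F'))"
    using assms(3-5,8) by (intro rtree.join[OF rtree.root]) auto
  then show ?case by simp
next
  case (join u W1 F1 u2 W2 F2 d)
  show ?case
  proof (cases "y \<in> W1")
    case True
    then have "rtree ends V E u (W1 \<union> W') (insert e (F1 \<union> F'))"
      using join by auto
    then have "rtree ends V E u ((W1 \<union> W') \<union> W2) (insert d (insert e (F1 \<union> F') \<union> F2))"
      by (rule rtree.join) (use join in auto)
    moreover have "(W1 \<union> W') \<union> W2 = (W1 \<union> W2) \<union> W'"
      "insert d (insert e (F1 \<union> F') \<union> F2) = insert e (insert d (F1 \<union> F2) \<union> F')" by auto
    ultimately show ?thesis by simp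
  next
    case False
    then have "rtree ends V E u2 (W2 \<union> W') (insert e (F2 \<union> F'))"
      using join by auto
    then have "rtree ends V E u (W1 \<union> (W2 \<union> W')) (insert d (F1 \<union> insert e (F2 \<union> F')))"
      by (rule rtree.join[OF join.hyps(1)]) (use join in auto)
    moreover have "W1 \<union> (W2 \<union> W') = (W1 \<union> W2) \<union> W'"
      "insert d (F1 \<union> insert e (F2 \<union> F')) = insert e (insert d (F1 \<union> F2) \<union> F')" by auto
    ultimately show ?thesis by simp
  qed
qed

section \<open>Extracting a tree from a connection and cutting it into an H-shape\<close>

lemma rtrancl_leaves_set:
  assumes "(x, y) \<in> r\<^sup>*" "x \<in> S" "y \<notin> S"
  shows "\<exists>a b. (a, b) \<in> r \<and> a \<in> S \<and> b \<notin> S"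
proof (rule ccontr)
  assume "\<nexists>a b. (a, b) \<in> r \<and> a \<in> S \<and> b \<notin> S"
  with assms(1,2) have "y \<in> S" by (induction rule: rtrancl_induct) auto
  with assms(3) show False by simp
qed

text \<open>A largest vertex set of a tree grown from \<open>u\<close> is all of \<open>W0\<close>:
  otherwise connectedness yields an edge leaving it, and gluing on that edge gives a larger
  one.\<close>

lemma spans_contains_rtree:
  assumes "finite V" "spans ends V E U F"
  obtains u W F' where "rtree ends V E u W F'" "U \<subseteq> W" "F' \<subseteq> F"
proof -
  obtain W0 where W0: "subgraph W0 F V E ends" "connected_graph W0 F ends" "U \<subseteq> W0"
    using assms(2) unfolding spans_def by blast
  have fin: "finite W0" using W0 assms(1) unfolding subgraph_def by (blast intro: finite_subset)
  obtain u where u: "u \<in> W0" using W0(2) unfolding connected_graph_def by blast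
  \<comment> \<open>The last conjunct keeps the edges of the tree inside \<open>W\<close>, so an
    edge that leaves \<open>W\<close> is certainly new, as edge-disjoint gluing demands.\<close>
  define good where "good W \<longleftrightarrow> W \<subseteq> W0 \<and> (\<exists>F'\<subseteq>F. rtree ends V E u W F' \<and> (\<forall>e\<in>F'. ends e \<subseteq> W))" for W
  have "good {u}"
    using u W0(1) rtree.root[of u V ends E] unfolding subgraph_def good_def by (intro conjI exI[of _ "{}"]) auto
  moreover have "\<forall>W. good W \<longrightarrow> card W < Suc (card W0)"
    using fin by (simp add: good_def card_mono less_Suc_eq_le)
  ultimately obtain W where W: "good W" "\<And>W'. good W' \<Longrightarrow> card W' \<le> card W"
    using ex_has_greatest_nat[of good "{u}" card "Suc (card W0)"] by blast
  then obtain F' where F': "F' \<subseteq> F" "rtree ends V E u W F'" "\<forall>e\<in>F'. ends e \<subseteq> W"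
    unfolding good_def by blast
  have "W \<subseteq> W0" using W(1) unfolding good_def by blast
  have "W0 \<subseteq> W"
  proof
    fix x assume x: "x \<in> W0"
    show "x \<in> W"
    proof (rule ccontr)
      assume "x \<notin> W"
      moreover have "(u, x) \<in> (adj F ends)\<^sup>*"
        using W0(2) u x unfolding connected_graph_def by blast
      ultimately obtain a b where ab: "(a, b) \<in> adj F ends" "a \<in> W" "b \<notin> W"
        using rtrancl_leaves_set[of u x "adj F ends" W] rtree_root[OF F'(2)] by blast
      then obtain e where e: "e \<in> F" "ends e = {a, b}" unfolding adj_def by blast
      have b: "b \<in> W0" "b \<in> V" "e \<in> E" using e W0(1) unfolding subgraph_def by blast+
      have "rtree ends V E u (W \<union> {b}) (insert e (F' \<union> {}))"
        by (rule rtree_attach[OF F'(2) ab(2) rtree.root[OF b(2)] b(3) e(2)]) (use ab(3) e(2) F'(3) in auto)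
      then have "good (insert b W)"
        unfolding good_def using \<open>W \<subseteq> W0\<close> b e F' ab
        by (intro conjI exI[of _ "insert e F'"]) auto
      then have "card (insert b W) \<le> card W" using W(2) by blast
      moreover have "finite W" using \<open>W \<subseteq> W0\<close> fin finite_subset by blast
      ultimately show False using ab by simp
    qed
  qed
  then show thesis using that[OF F'(2)] W0(3) F'(1) by blast
qed

text \<open>A minimal piece of the recursive decomposition with at least three terminals has at most four.\<close>
lemma rtree_split_three:
  assumes "rtree ends V E u W F" "finite X" "X \<subseteq> W" "3 \<le> card X"
  shows "\<exists>w S FS R FR X'. rtree ends V E w S FS \<and> rtree ends V E w R FR \<and> FS \<inter> FR = {} \<and>
    FS \<subseteq> F \<and> FR \<subseteq> F \<and> X' \<subseteq> X \<and> X' \<subseteq> S \<and> insert u (X - X') \<subseteq> R \<and> 3 \<le> card X' \<and> card X' \<le> 4"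
  using assms
proof (induction arbitrary: X rule: rtree.induct)
  case (root u)
  then have "card X \<le> 1" using card_mono[of "{u}" X] by simp
  then show ?case using root by simp
next
  case (join u W1 F1 u2 W2 F2 d)
  have u: "u \<in> W1" "u2 \<in> W2" by (rule rtree_root[OF join.hyps(1)], rule rtree_root[OF join.hyps(2)])
  \<comment> \<open>The vertex sets of the halves may overlap, so terminals in \<open>W1\<close> are
    charged to the first half and only the others to the second.\<close>
  consider "3 \<le> card (X \<inter> W1)" | "3 \<le> card (X - W1)" | "card (X \<inter> W1) \<le> 2" "card (X - W1) \<le> 2"
    by linarith
  then show ?case
  proof cases
    case 1
    have "finite (X \<inter> W1)" "X \<inter> W1 \<subseteq> W1" using join.prems by auto
    from join.IH(1)[OF this 1] obtain w S FS R FR X' where *: "rtree ends V E w S FS" "rtree ends V E w R FR" "FS \<inter> FR = {}"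
      "FS \<subseteq> F1" "FR \<subseteq> F1" "X' \<subseteq> X \<inter> W1" "X' \<subseteq> S" "insert u (X \<inter> W1 - X') \<subseteq> R"
      "3 \<le> card X'" "card X' \<le> 4"
      by (elim exE conjE) (rule that)
    \<comment> \<open>The remainder \<open>R\<close> still contains the old root \<open>u\<close>,
      so the other half can be hung onto it there by the edge \<open>d\<close>. This is why the
      conclusion carries \<open>insert u\<close>.\<close>
    have "rtree ends V E w (R \<union> W2) (insert d (FR \<union> F2))"
      by (rule rtree_attach[OF *(2) _ join.hyps(2,3,4)]) (use join.hyps(5-7) *(5,8) in blast)+
    then show ?thesis
      using *(1,9,10)
      by - (rule exI[of _ w], rule exI[of _ S], rule exI[of _ FS], rule exI[of _ "R \<union> W2"],
          rule exI[of _ "insert d (FR \<union> F2)"], rule exI[of _ X'],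
          (intro conjI; (assumption | use *(3-8) join.hyps(5-7) join.prems(2) in blast)))
  next
    case 2
    have "finite (X - W1)" "X - W1 \<subseteq> W2" using join.prems by auto
    from join.IH(2)[OF this 2] obtain w S FS R FR X' where *: "rtree ends V E w S FS" "rtree ends V E w R FR" "FS \<inter> FR = {}"
      "FS \<subseteq> F2" "FR \<subseteq> F2" "X' \<subseteq> X - W1" "X' \<subseteq> S" "insert u2 (X - W1 - X') \<subseteq> R"
      "3 \<le> card X'" "card X' \<le> 4"
      by (elim exE conjE) (rule that)
    have "rtree ends V E w (R \<union> W1) (insert d (FR \<union> F1))"
      by (rule rtree_attach[OF *(2) _ join.hyps(1,3)]) (use join.hyps(4-7) *(5,8) in blast)+
    then show ?thesis
      using *(1,9,10)
      by - (rule exI[of _ w], rule exI[of _ S], rule exI[of _ FS], rule exI[of _ "R \<union> W1"],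
          rule exI[of _ "insert d (FR \<union> F1)"], rule exI[of _ X'],
          (intro conjI; (assumption | use *(3-8) join.hyps(5-7) join.prems(2) u in blast)))
  next
    case 3
    \<comment> \<open>Neither half is charged with three terminals: the whole tree is the piece, and
      the remainder is the bare root.\<close>
    have "card X = card (X \<inter> W1) + card (X - W1)"
      using join.prems by (metis card_Int_Diff)
    then have "card X \<le> 4" using 3 by simp
    moreover have "rtree ends V E u (W1 \<union> W2) (insert d (F1 \<union> F2))" by (rule rtree.join[OF join.hyps])
    moreover have "rtree ends V E u {u} {}" by (rule rtree.root) (use u rtree_subset[OF join.hyps(1)] in blast)
    ultimately show ?thesis
      using join.prems by - (rule exI[of _ u], rule exI[of _ "W1 \<union> W2"], rule exI[of _ "insert d (F1 \<union> F2)"], rule exI[of _ "{u}"],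
          rule exI[of _ "{}"], rule exI[of _ X],
          (intro conjI; (assumption | simp)))
  qed
qed

text \<open>Descend as long as all terminals lie in one half, recording the way from the root in
  \<open>P\<close>. Where this fails is the branch vertex \<open>w\<close>, and its two halves
  separate the terminals.\<close>

lemma rtree_branch:
  assumes "rtree ends V E u W F" "X \<subseteq> W" "finite X" "2 \<le> card X"
  shows "\<exists>w P F1 F2 X1 X2. spans ends V E {u, w} P \<and> spans ends V E (insert w X1) F1 \<and>
    spans ends V E (insert w X2) F2 \<and> P \<subseteq> F \<and> F1 \<subseteq> F \<and> F2 \<subseteq> F \<and>
    P \<inter> F1 = {} \<and> P \<inter> F2 = {} \<and> F1 \<inter> F2 = {} \<and> X = X1 \<union> X2 \<and> X1 \<inter> X2 = {} \<and> X1 \<noteq> {} \<and> X2 \<noteq> {}"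
  using assms
proof (induction arbitrary: X rule: rtree.induct)
  case (root u)
  then have "card X \<le> 1" using card_mono[of "{u}" X] by simp
  then show ?case using root by simp
next
  case (join u W1 F1 u2 W2 F2 d)
  have u: "u \<in> W1" "u2 \<in> W2" by (rule rtree_root[OF join.hyps(1)], rule rtree_root[OF join.hyps(2)])
  have V: "u \<in> V" "u2 \<in> V" using u rtree_subset[OF join.hyps(1)] rtree_subset[OF join.hyps(2)] by auto
  have d: "spans ends V E {u, u2} {d}" using V join.hyps by (intro spans_edge) auto
  consider "X \<subseteq> W1" | "X \<subseteq> W2" | "X \<inter> W1 \<noteq> {}" "X - W1 \<noteq> {}"
    using join.prems by blast
  then show ?case
  proof cases
    case 1
    from join.IH(1)[OF 1 join.prems(2,3)] obtain w P G1 G2 X1 X2 where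
      *: "spans ends V E {u, w} P" "spans ends V E (insert w X1) G1"
      "spans ends V E (insert w X2) G2" "P \<subseteq> F1" "G1 \<subseteq> F1" "G2 \<subseteq> F1"
      "P \<inter> G1 = {}" "P \<inter> G2 = {}" "G1 \<inter> G2 = {}" "X = X1 \<union> X2" "X1 \<inter> X2 = {}" "X1 \<noteq> {}" "X2 \<noteq> {}"
      by (elim exE conjE) (rule that)
    then show ?thesis
      by - (rule exI[of _ w], rule exI[of _ P], rule exI[of _ G1], rule exI[of _ G2],
          rule exI[of _ X1], rule exI[of _ X2],
          (intro conjI; (assumption | use *(4-6) in blast)))
  next
    case 2
    from join.IH(2)[OF 2 join.prems(2,3)] obtain w P G1 G2 X1 X2 where *: "spans ends V E {u2, w} P" "spans ends V E (insert w X1) G1"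
      "spans ends V E (insert w X2) G2" "P \<subseteq> F2" "G1 \<subseteq> F2" "G2 \<subseteq> F2"
      "P \<inter> G1 = {}" "P \<inter> G2 = {}" "G1 \<inter> G2 = {}" "X = X1 \<union> X2" "X1 \<inter> X2 = {}" "X1 \<noteq> {}" "X2 \<noteq> {}"
      by (elim exE conjE) (rule that)
    have "spans ends V E ({u, u2} \<union> {u2, w}) ({d} \<union> P)"
      by (rule spans_union[OF d *(1), of u2]) simp_all
    then have "spans ends V E {u, w} ({d} \<union> P)" by (rule spans_mono) blast
    then have "spans ends V E {u, w} (insert d P)" by simp
    then show ?thesis using *(2,3,9-13)
      by - (rule exI[of _ w], rule exI[of _ "insert d P"], rule exI[of _ G1], rule exI[of _ G2],
          rule exI[of _ X1], rule exI[of _ X2],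
          (intro conjI; (assumption | use *(4-8) join.hyps(5-7) in blast)))
  next
    case 3
    have 1: "spans ends V E W1 F1" "spans ends V E W2 F2" by (rule rtree_spans[OF join.hyps(1)], rule rtree_spans[OF join.hyps(2)])
    \<comment> \<open>The edge \<open>d\<close> is charged to the second branch, which has to reach
      \<open>u\<close>.\<close>
    have "spans ends V E ({u, u2} \<union> W2) ({d} \<union> F2)"
      by (rule spans_union[OF d 1(2), of u2]) (use u in simp_all)
    then have "spans ends V E (insert u (X - W1)) ({d} \<union> F2)"
      by (rule spans_mono) (use join.prems in blast)
    then have "spans ends V E (insert u (X - W1)) (insert d F2)" by simp
    moreover have "spans ends V E (insert u (X \<inter> W1)) F1"
      by (rule spans_mono[OF 1(1)]) (use u in blast)
    moreover have "spans ends V E {u, u} {}" using spans_singleton[OF V(1)] by simp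
    ultimately show ?thesis using 3
      by - (rule exI[of _ u], rule exI[of _ "{}"], rule exI[of _ F1], rule exI[of _ "insert d F2"],
          rule exI[of _ "X \<inter> W1"], rule exI[of _ "X - W1"],
          (intro conjI; (assumption | use join.hyps(5-7) in blast)))
  qed
qed

lemma spans_H_shape:
  assumes "finite V" "spans ends V E A F" "finite A" "7 \<le> card A"
  obtains w z X1 X2 Y1 Y2 S1 S2 P R1 R2 where
    "spans ends V E (insert w X1) S1" "spans ends V E (insert w X2) S2" "spans ends V E {w, z} P"
    "spans ends V E (insert z Y1) R1" "spans ends V E (insert z Y2) R2"
    "S1 \<inter> S2 = {}" "(S1 \<union> S2) \<inter> P = {}" "R1 \<inter> R2 = {}" "(S1 \<union> S2 \<union> P) \<inter> (R1 \<union> R2) = {}"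
    "S1 \<union> S2 \<union> P \<union> R1 \<union> R2 \<subseteq> F"
    "A = X1 \<union> X2 \<union> Y1 \<union> Y2" "X1 \<inter> X2 = {}" "Y1 \<inter> Y2 = {}" "(X1 \<union> X2) \<inter> (Y1 \<union> Y2) = {}"
    "X1 \<noteq> {}" "X2 \<noteq> {}" "Y1 \<noteq> {}" "Y2 \<noteq> {}" "3 \<le> card (X1 \<union> X2)" "3 \<le> card (Y1 \<union> Y2)"
proof -
  obtain u W F' where T: "rtree ends V E u W F'" "A \<subseteq> W" "F' \<subseteq> F"
    using spans_contains_rtree[OF assms(1,2)] by metis
  have "3 \<le> card A" using assms(4) by simp
  from rtree_split_three[OF T(1) assms(3) T(2) this]
  obtain c S FS R FR X where *: "rtree ends V E c S FS" "rtree ends V E c R FR" "FS \<inter> FR = {}"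
    "FS \<subseteq> F'" "FR \<subseteq> F'" "X \<subseteq> A" "X \<subseteq> S" "insert u (A - X) \<subseteq> R" "3 \<le> card X" "card X \<le> 4"
    by (elim exE conjE) (rule that)
  have fin: "finite X" "finite (A - X)" using *(6) assms(3) finite_subset by auto
  have "card (A - X) = card A - card X" using *(6) fin by (simp add: card_Diff_subset)
  then have cY: "3 \<le> card (A - X)" using *(10) assms(4) by simp
  have "2 \<le> card X" using *(9) by simp
  from rtree_branch[OF *(1) *(7) fin(1) this]
  obtain w P S1 S2 X1 X2 where X: "spans ends V E {c, w} P" "spans ends V E (insert w X1) S1"
    "spans ends V E (insert w X2) S2" "P \<subseteq> FS" "S1 \<subseteq> FS" "S2 \<subseteq> FS"
    "P \<inter> S1 = {}" "P \<inter> S2 = {}" "S1 \<inter> S2 = {}" "X = X1 \<union> X2" "X1 \<inter> X2 = {}" "X1 \<noteq> {}" "X2 \<noteq> {}"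
    by (elim exE conjE) (rule that)
  have "A - X \<subseteq> R" "2 \<le> card (A - X)" using *(8) cY by auto
  from rtree_branch[OF *(2) this(1) fin(2) this(2)]
  obtain z Q R1 R2 Y1 Y2 where Y: "spans ends V E {c, z} Q" "spans ends V E (insert z Y1) R1"
    "spans ends V E (insert z Y2) R2" "Q \<subseteq> FR" "R1 \<subseteq> FR" "R2 \<subseteq> FR"
    "Q \<inter> R1 = {}" "Q \<inter> R2 = {}" "R1 \<inter> R2 = {}" "A - X = Y1 \<union> Y2" "Y1 \<inter> Y2 = {}" "Y1 \<noteq> {}" "Y2 \<noteq> {}"
    by (elim exE conjE) (rule that)
  \<comment> \<open>Both pieces were branched from their common root \<open>c\<close>, so the two
    ways from \<open>c\<close> join into one connection between the branch vertices.\<close>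
  have "spans ends V E ({c, w} \<union> {c, z}) (P \<union> Q)"
    by (rule spans_union[OF X(1) Y(1), of c]) simp_all
  then have PQ: "spans ends V E {w, z} (P \<union> Q)" by (rule spans_mono) blast
  have "(S1 \<union> S2) \<inter> (P \<union> Q) = {}" "(S1 \<union> S2 \<union> (P \<union> Q)) \<inter> (R1 \<union> R2) = {}"
    using X(4-8) Y(4-8) *(3) by blast+
  moreover have "S1 \<union> S2 \<union> (P \<union> Q) \<union> R1 \<union> R2 \<subseteq> F"
    using X(4-6) Y(4-6) *(4,5) T(3) by blast
  moreover have "A = X1 \<union> X2 \<union> Y1 \<union> Y2" "(X1 \<union> X2) \<inter> (Y1 \<union> Y2) = {}"
    using X(10) Y(10) *(6) by blast+
  moreover have "3 \<le> card (X1 \<union> X2)" "3 \<le> card (Y1 \<union> Y2)"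
    using X(10) Y(10) *(9) cY by simp_all
  ultimately show thesis
    by - (rule that[OF X(2,3) PQ Y(2,3) X(9) _ Y(9) _ _ _ X(11) Y(11) _ X(12,13) Y(12,13)])
qed

section \<open>Arcs of a cycle\<close>

lemma glen_nonneg: "(\<And>x. x \<in> F \<Longrightarrow> 0 \<le> len x) \<Longrightarrow> 0 \<le> glen len F"
  unfolding glen_def by (rule sum_nonneg)

lemma glen_mono:
  "\<lbrakk>F \<subseteq> F'; finite F'; \<And>x. x \<in> F' \<Longrightarrow> 0 \<le> len x\<rbrakk> \<Longrightarrow> glen len F \<le> glen len F'"
  unfolding glen_def by (rule sum_mono2) auto

lemma glen_union_le:
  assumes "finite F" "finite F'" "\<And>x. x \<in> F \<union> F' \<Longrightarrow> 0 \<le> len x"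
  shows "glen len (F \<union> F') \<le> glen len F + glen len F'"
proof -
  have "glen len F + glen len F' = glen len (F \<union> F') + glen len (F \<inter> F')"
    unfolding glen_def using sum.union_inter[OF assms(1,2), of len] by simp
  moreover have "0 \<le> glen len (F \<inter> F')" using assms(3) by (intro glen_nonneg) auto
  ultimately show ?thesis by simp
qed

lemma glen_union_disjoint:
  "\<lbrakk>finite F; finite F'; F \<inter> F' = {}\<rbrakk> \<Longrightarrow> glen len (F \<union> F') = glen len F + glen len F'"
  unfolding glen_def by (rule sum.union_disjoint)

section \<open>Arcs and cuts of a numbered cycle\<close>

locale cycle_graph =
  fixes ends :: "'e \<Rightarrow> 'v set" and v :: "nat \<Rightarrow> 'v" and e :: "nat \<Rightarrow> 'e" and n :: nat
  assumes n: "0 < n" and inj_v: "inj_on v {..<n}" and inj_e: "inj_on e {..<n}"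
    and ends: "i < n \<Longrightarrow> ends (e i) = {v i, v (Suc i mod n)}"
begin

abbreviation "csp \<equiv> spans ends (v ` {..<n}) (e ` {..<n})"

lemma inj_v_iff: "i < n \<Longrightarrow> j < n \<Longrightarrow> v i = v j \<longleftrightarrow> i = j"
  using inj_v by (auto dest: inj_onD)

lemma csp_edge: "i < n \<Longrightarrow> csp {v i, v (Suc i mod n)} {e i}"
  using ends n by (intro spans_edge) auto

lemma csp_path: "p \<le> r \<Longrightarrow> r < n \<Longrightarrow> csp (v ` {p..r}) (e ` {p..<r})"
proof (induction r rule: dec_induct)
  case base
  then show ?case using spans_singleton[of "v p" "v ` {..<n}"] by simp
next
  case (step r)
  have "csp {v r, v (Suc r)} {e r}" using csp_edge[of r] step by simp
  with step have "csp (v ` {p..r} \<union> {v r, v (Suc r)}) (e ` {p..<r} \<union> {e r})"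
    by (intro spans_union[where x = "v r"]) auto
  moreover have "v ` {p..r} \<union> {v r, v (Suc r)} = v ` {p..Suc r}" "e ` {p..<r} \<union> {e r} = e ` {p..<Suc r}"
    using step by (auto simp: atLeastAtMostSuc_conv atLeastLessThanSuc)
  ultimately show ?case by simp
qed

text \<open>The complementary arc, running from \<open>v r\<close> over the wrap-around edge
  \<open>e (n - 1)\<close> to \<open>v p\<close>. Edge ranges are half-open because
  \<open>e i\<close> starts at \<open>v i\<close>. For \<open>p = r\<close> the arc is the whole
  cycle.\<close>

lemma csp_outer:
  assumes "p \<le> r" "r < n"
  shows "csp (v ` ({..p} \<union> {r..<n})) (e ` ({..<p} \<union> {r..<n}))"
proof -
  have n1: "n - 1 < n" "Suc (n - 1) mod n = 0" using n by auto
  have "csp (v ` {0..p}) (e ` {0..<p})" using assms by (intro csp_path) auto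
  moreover have "csp {v (n - 1), v 0} {e (n - 1)}" using csp_edge[OF n1(1)] n1 by simp
  ultimately have "csp (v ` {0..p} \<union> {v (n - 1), v 0}) (e ` {0..<p} \<union> {e (n - 1)})"
    by (rule spans_union[where x = "v 0"]) auto
  moreover have "csp (v ` {r..n - 1}) (e ` {r..<n - 1})" using assms by (intro csp_path) auto
  ultimately have "csp ((v ` {0..p} \<union> {v (n - 1), v 0}) \<union> v ` {r..n - 1})
      ((e ` {0..<p} \<union> {e (n - 1)}) \<union> e ` {r..<n - 1})"
    by (rule spans_union[where x = "v (n - 1)"]) (use assms in auto)
  moreover have "(e ` {0..<p} \<union> {e (n - 1)}) \<union> e ` {r..<n - 1} = e ` ({0..<p} \<union> {n - 1} \<union> {r..<n - 1})"
    by blast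
  moreover have "\<dots> = e ` ({..<p} \<union> {r..<n})"
    by (rule arg_cong[where f = "image e"]) (use assms in auto)
  ultimately have "csp ((v ` {0..p} \<union> {v (n - 1), v 0}) \<union> v ` {r..n - 1}) (e ` ({..<p} \<union> {r..<n}))"
    by (simp only:)
  then show ?thesis by (rule spans_mono) (use assms in force)
qed

lemma csp_whole: "U \<subseteq> v ` {..<n} \<Longrightarrow> csp U (e ` {..<n})"
  using spans_mono[OF csp_outer[of 0 0], of U] n by (simp add: lessThan_atLeast0 insert_absorb)

text \<open>Deleting the edges \<open>e lo\<close> and \<open>e hi\<close> splits the cycle into two
  arcs, and every other edge has both ends in the same one.\<close>

lemma csp_cut:
  assumes F: "F \<subseteq> e ` {..<n}" and lo: "lo < hi" "hi < n" "e lo \<notin> F" "e hi \<notin> F"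
    and xy: "(x, y) \<in> (adj F ends)\<^sup>*"
  shows "x \<in> v ` {Suc lo..hi} \<longleftrightarrow> y \<in> v ` {Suc lo..hi}"
  using xy
proof (induction rule: rtrancl_induct)
  case base
  show ?case by simp
next
  case (step y z)
  then obtain f where f: "f \<in> F" "ends f = {y, z}" unfolding adj_def by blast
  then obtain m where m: "m < n" "f = e m" using F by blast
  have "m \<noteq> lo" "m \<noteq> hi" using f m lo by auto
  have mem: "v i \<in> v ` {Suc lo..hi} \<longleftrightarrow> lo < i \<and> i \<le> hi" if "i < n" for i
    using that lo inj_v_iff by (auto simp: image_iff)
  have "v m \<in> v ` {Suc lo..hi} \<longleftrightarrow> v (Suc m mod n) \<in> v ` {Suc lo..hi}"
  proof (cases "Suc m < n")
    case True
    then show ?thesis using mem m \<open>m \<noteq> lo\<close> \<open>m \<noteq> hi\<close> by auto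
  next
    case False
    then have "Suc m = n" using m by simp
    then show ?thesis using mem[of m] mem[of 0] m lo \<open>m \<noteq> hi\<close> by auto
  qed
  moreover have "{y, z} = {v m, v (Suc m mod n)}" using f m ends by simp
  ultimately show ?case using step.IH by (metis doubleton_eq_iff)
qed

text \<open>If each of the two arcs between \<open>v p\<close> and \<open>v r\<close> lacked an
  edge, the two missing edges would separate these vertices.\<close>

lemma csp_arc:
  assumes "csp U F" "v p \<in> U" "v r \<in> U" "p < r" "r < n"
  shows "e ` {p..<r} \<subseteq> F \<or> e ` ({..<p} \<union> {r..<n}) \<subseteq> F"
proof (rule ccontr)
  assume "\<not> ?thesis"
  then obtain i j where i: "i \<in> {p..<r}" "e i \<notin> F" and j: "j \<in> {..<p} \<union> {r..<n}" "e j \<notin> F"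
    by blast
  obtain W where W: "subgraph W F (v ` {..<n}) (e ` {..<n}) ends" "connected_graph W F ends" "U \<subseteq> W"
    using assms(1) unfolding spans_def by blast
  have F: "F \<subseteq> e ` {..<n}" using W(1) unfolding subgraph_def by blast
  have pr: "(v p, v r) \<in> (adj F ends)\<^sup>*"
    using W assms unfolding connected_graph_def by blast
  have mem: "v k \<in> v ` {Suc lo..hi} \<longleftrightarrow> lo < k \<and> k \<le> hi" if "k < n" "hi < n" for k lo hi
    using that inj_v_iff by (auto simp: image_iff)
  show False
  proof (cases "j < p")
    case True
    then have "v p \<in> v ` {Suc j..i} \<longleftrightarrow> v r \<in> v ` {Suc j..i}"
      using i j assms by (intro csp_cut[OF F _ _ _ _ pr]) auto
    then show False using mem[of p i j] mem[of r i j] True i assms by auto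
  next
    case False
    then have "v p \<in> v ` {Suc i..j} \<longleftrightarrow> v r \<in> v ` {Suc i..j}"
      using i j assms by (intro csp_cut[OF F _ _ _ _ pr]) auto
    then show False using mem[of p j i] mem[of r j i] False i j assms by auto
  qed
qed

lemma csp_incident:
  assumes "csp U F" "\<And>x. x \<in> U' \<Longrightarrow> \<exists>i<n. e i \<in> F \<and> x = v i"
  shows "csp (U \<union> U') F"
proof (rule spans_incident[OF assms(1)])
  fix x assume "x \<in> U'"
  then obtain i where "i < n" "e i \<in> F" "x = v i" using assms(2) by blast
  then show "\<exists>f\<in>F. x \<in> ends f" using ends by auto
qed

lemma rotate:
  assumes "k < n"
  shows "cycle_graph ends (\<lambda>i. v ((i + k) mod n)) (\<lambda>i. e ((i + k) mod n)) n"
    and "(\<lambda>i. v ((i + k) mod n)) ` {..<n} = v ` {..<n}"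
    and "(\<lambda>i. e ((i + k) mod n)) ` {..<n} = e ` {..<n}"
proof -
  let ?f = "\<lambda>i. (i + k) mod n"
  have md: "?f i = (if i + k < n then i + k else i + k - n)" if "i < n" for i
    using that assms by (simp add: le_mod_geq)
  have f_inj: "inj_on ?f {..<n}"
    by (rule inj_onI) (use md assms in \<open>auto split: if_splits\<close>)
  have f_im: "?f ` {..<n} = {..<n}"
    using f_inj n by (intro endo_inj_surj) auto
  show "(\<lambda>i. v (?f i)) ` {..<n} = v ` {..<n}" "(\<lambda>i. e (?f i)) ` {..<n} = e ` {..<n}"
    using f_im by (metis image_image)+
  have "inj_on (v \<circ> ?f) {..<n}" "inj_on (e \<circ> ?f) {..<n}"
    using f_inj f_im inj_v inj_e by (auto intro: comp_inj_on)
  then show "cycle_graph ends (\<lambda>i. v (?f i)) (\<lambda>i. e (?f i)) n"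
    using n ends by unfold_locales (simp_all add: comp_def mod_simps)
qed

end

text \<open>A minimal counterexample \<open>A\<close>: the graph connects \<open>A\<close> at cost \<open>t\<close>, the cycle does not, and
  \<open>K B\<close> is an optimal connection inside the cycle of a proper subset \<open>B\<close>.\<close>
locale shortcut_cycle = cycle_graph ends v e n
  for ends :: "'e \<Rightarrow> 'v set" and v :: "nat \<Rightarrow> 'v" and e :: "nat \<Rightarrow> 'e" and n :: nat +
  fixes len :: "'e \<Rightarrow> real" and A :: "'v set" and t :: real and K :: "'v set \<Rightarrow> 'e set"
  assumes len_nonneg: "i < n \<Longrightarrow> 0 \<le> len (e i)"
    and A_sub: "A \<subseteq> v ` {..<n}"
    and heavy: "csp A F \<Longrightarrow> t < glen len F"
    and K_csp: "B \<subset> A \<Longrightarrow> B \<noteq> {} \<Longrightarrow> csp B (K B)"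
    and K_light: "B \<subset> A \<Longrightarrow> B \<noteq> {} \<Longrightarrow> glen len (K B) \<le> t"
begin

text \<open>The coordinate of \<open>v i\<close> after cutting the cycle open at \<open>v 0\<close>;
  \<open>pos n\<close> is the length of the cycle. Arc lengths become differences, which reduces the
  final estimate to linear arithmetic.\<close>

definition pos :: "nat \<Rightarrow> real" where
  "pos i = (\<Sum>j<i. len (e j))"

lemma glen_image: "J \<subseteq> {..<n} \<Longrightarrow> glen len (e ` J) = (\<Sum>j\<in>J. len (e j))"
  unfolding glen_def using inj_on_subset[OF inj_e] by (simp add: sum.reindex)

lemma sum_inner: "p \<le> r \<Longrightarrow> (\<Sum>j\<in>{p..<r}. len (e j)) = pos r - pos p"
  unfolding pos_def using sum.atLeastLessThan_concat[of 0 p r "\<lambda>j. len (e j)"]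
  by (simp add: lessThan_atLeast0)

lemma sum_outer:
  "p \<le> r \<Longrightarrow> r \<le> n \<Longrightarrow> (\<Sum>j\<in>{..<p} \<union> {r..<n}. len (e j)) = pos n - (pos r - pos p)"
  using sum_inner[of r n] by (subst sum.union_disjoint) (auto simp: pos_def)

lemma pos_mono: "p \<le> r \<Longrightarrow> r \<le> n \<Longrightarrow> pos p \<le> pos r"
  unfolding pos_def by (rule sum_mono2) (auto intro: len_nonneg)

lemma csp_finite: "csp U F \<Longrightarrow> finite F"
  by (rule finite_subset[OF spans_imp_subset]) auto

lemma csp_len_nonneg: "csp U F \<Longrightarrow> x \<in> F \<Longrightarrow> 0 \<le> len x"
  using len_nonneg by (auto dest!: spans_imp_subset)

lemma heavy_inner:
  assumes "p \<le> r" "r < n" "A \<subseteq> v ` {p..r}"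
  shows "t < pos r - pos p"
proof -
  have "{p..<r} \<subseteq> {..<n}" using assms by auto
  from glen_image[OF this] show ?thesis
    using heavy[OF spans_mono[OF csp_path[OF assms(1,2)] assms(3)]] sum_inner[OF assms(1)] by simp
qed

lemma heavy_outer:
  assumes "p \<le> r" "r < n" "A \<subseteq> v ` ({..p} \<union> {r..<n})"
  shows "t < pos n - (pos r - pos p)"
proof -
  have "{..<p} \<union> {r..<n} \<subseteq> {..<n}" using assms by auto
  from glen_image[OF this] show ?thesis
    using heavy[OF spans_mono[OF csp_outer[OF assms(1,2)] assms(3)]] sum_outer[of p r] assms(1,2) by simp
qed

lemma glen_ge:
  assumes "csp U F" "e ` J \<subseteq> F" "J \<subseteq> {..<n}"
  shows "(\<Sum>j\<in>J. len (e j)) \<le> glen len F"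
proof -
  have "glen len (e ` J) \<le> glen len F"
    using assms(2) csp_finite[OF assms(1)] csp_len_nonneg[OF assms(1)] by (rule glen_mono)
  then show ?thesis using glen_image[OF assms(3)] by simp
qed

text \<open>A case rule, since both facts are used later: the containment for contradictions, the
  length for the estimate. The degenerate case \<open>p = r\<close> falls under the first
  alternative.\<close>

lemma csp_arc_len:
  assumes "csp U F" "v p \<in> U" "v r \<in> U" "p \<le> r" "r < n"
  obtains "e ` {p..<r} \<subseteq> F" "pos r - pos p \<le> glen len F"
  | "e ` ({..<p} \<union> {r..<n}) \<subseteq> F" "pos n - (pos r - pos p) \<le> glen len F"
proof (cases "p = r")
  case True
  moreover have "0 \<le> glen len F" using csp_len_nonneg[OF assms(1)] by (rule glen_nonneg)
  ultimately show thesis using that by simp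
next
  case False
  then have "p < r" using assms(4) by simp
  have J: "{p..<r} \<subseteq> {..<n}" "{..<p} \<union> {r..<n} \<subseteq> {..<n}" using assms(4,5) by auto
  from csp_arc[OF assms(1-3) \<open>p < r\<close> assms(5)] show thesis
  proof
    assume "e ` {p..<r} \<subseteq> F"
    then show thesis
      using that(1) glen_ge[OF assms(1) _ J(1)] sum_inner[of p r] assms(4) by simp
  next
    assume "e ` ({..<p} \<union> {r..<n}) \<subseteq> F"
    then show thesis
      using that(2) glen_ge[OF assms(1) _ J(2)] sum_outer[of p r] assms(4,5) by simp
  qed
qed

section \<open>Optimal connections that touch or cross\<close>

lemma heavy_incident:
  assumes "csp U F" "\<And>x. x \<in> A - U \<Longrightarrow> \<exists>i<n. e i \<in> F \<and> x = v i"
  shows "t < glen len F"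
proof -
  have "csp (U \<union> (A - U)) F" using assms by (rule csp_incident)
  then have "csp A F" by (rule spans_mono) blast
  then show ?thesis by (rule heavy)
qed

text \<open>The edge \<open>e i\<close> takes \<open>F\<close> through a vertex of
  \<open>U'\<close>, so \<open>F\<close> and \<open>F'\<close> together form one connection of
  \<open>A\<close>.\<close>

lemma heavy_touch:
  assumes "csp U F" "csp U' F'" "A \<subseteq> U \<union> U'" "i < n" "e i \<in> F" "v i \<in> U'"
  shows "t < glen len F + glen len F'"
proof -
  have "csp (U \<union> {v i}) F" using assms by (intro csp_incident) auto
  from spans_union[OF this assms(2), of "v i"]
  have "csp (U \<union> {v i} \<union> U') (F \<union> F')" using assms by auto
  then have "csp A (F \<union> F')" by (rule spans_mono) (use assms(3) in blast)
  then have "t < glen len (F \<union> F')" by (rule heavy)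
  also have "\<dots> \<le> glen len F + glen len F'"
    using csp_finite[OF assms(1)] csp_finite[OF assms(2)] csp_len_nonneg[OF assms(1)] csp_len_nonneg[OF assms(2)]
    by (intro glen_union_le) auto
  finally show ?thesis .
qed

text \<open>Of the two arcs between \<open>v p\<close> and \<open>v r\<close>, one passes
  \<open>v q\<close> and the other \<open>v s\<close>. \<open>K Z\<close> contains one of them,
  hence touches \<open>Z'\<close>.\<close>

lemma no_cross:
  assumes "Z \<union> Z' = A" "Z \<inter> Z' = {}" "glen len (K Z) + glen len (K Z') \<le> t"
    "v p \<in> Z" "v q \<in> Z'" "v r \<in> Z" "v s \<in> Z'" "p < q" "q < r" "r < s" "s < n"
  shows False
proof -
  have Z: "csp Z (K Z)" "csp Z' (K Z')" using assms(1,2,4,5) by (auto intro!: K_csp)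
  have "e q \<in> K Z \<or> e s \<in> K Z"
  proof -
    have "q \<in> {p..<r}" "s \<in> {..<p} \<union> {r..<n}" "p < r" "r < n" using assms(8-11) by auto
    then show ?thesis using csp_arc[OF Z(1) assms(4,6)] by blast
  qed
  then have "t < glen len (K Z) + glen len (K Z')"
    using heavy_touch[OF Z, of q] heavy_touch[OF Z, of s] assms by auto
  then show False using assms(3) by simp
qed

text \<open>\<open>q\<close> stands for the length of the middle path of the H-shape. The parallel
  pairing leaves it out and the crossing pairing pays for it twice, so it cancels when the two
  bounds are added.\<close>

lemma ordered_quartet_false:
  assumes sub: "a \<union> b \<union> c \<union> d \<subseteq> {..<n}"
    and ne: "a \<noteq> {}" "b \<noteq> {}" "c \<noteq> {}" "d \<noteq> {}"
    and ab: "\<And>i j. i \<in> a \<Longrightarrow> j \<in> b \<Longrightarrow> i < j"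
    and bc: "\<And>i j. i \<in> b \<Longrightarrow> j \<in> c \<Longrightarrow> i < j"
    and cd: "\<And>i j. i \<in> c \<Longrightarrow> j \<in> d \<Longrightarrow> i < j"
    and A: "A = v ` (a \<union> b \<union> c \<union> d)"
    and cab: "3 \<le> card (a \<union> b)" and ccd: "3 \<le> card (c \<union> d)"
    and q: "0 \<le> q"
    and par: "glen len (K (v ` (a \<union> b))) + glen len (K (v ` (c \<union> d))) + q \<le> t"
    and crs: "glen len (K (v ` (a \<union> c))) + glen len (K (v ` (b \<union> d))) \<le> t + q"
  shows False
proof -
  have fin: "finite a" "finite b" "finite c" "finite d"
    using sub finite_subset[of _ "{..<n}"] by auto
  define a0 a1 b0 b1 c0 c1 d0 d1 where
    defs: "a0 = Min a" "a1 = Max a" "b0 = Min b" "b1 = Max b" "c0 = Min c" "c1 = Max c" "d0 = Min d" "d1 = Max d"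
  have mem: "a0 \<in> a" "a1 \<in> a" "b0 \<in> b" "b1 \<in> b" "c0 \<in> c" "c1 \<in> c" "d0 \<in> d" "d1 \<in> d"
    using fin ne by (simp_all add: defs)
  have bnd: "\<And>i. i \<in> a \<Longrightarrow> a0 \<le> i \<and> i \<le> a1" "\<And>i. i \<in> b \<Longrightarrow> b0 \<le> i \<and> i \<le> b1"
    "\<And>i. i \<in> c \<Longrightarrow> c0 \<le> i \<and> i \<le> c1" "\<And>i. i \<in> d \<Longrightarrow> d0 \<le> i \<and> i \<le> d1"
    using fin by (simp_all add: defs)
  have ord: "a0 \<le> a1" "a1 < b0" "b0 \<le> b1" "b1 < c0" "c0 \<le> c1" "c1 < d0" "d0 \<le> d1" "d1 < n"
    using bnd mem ab bc cd sub by auto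
  have inj: "inj_on v (a \<union> b \<union> c \<union> d)" using inj_v sub by (rule inj_on_subset)
  have psub: "v ` I \<subset> A" if "I \<subset> a \<union> b \<union> c \<union> d" for I
    unfolding A using inj that by (rule image_strict_mono)
  have nin: "a0 \<notin> b" "a0 \<notin> c" "a0 \<notin> d" "b0 \<notin> a" "b0 \<notin> c" "c0 \<notin> a" "c0 \<notin> b"
    using bnd(1)[of c0] bnd(1)[of b0] bnd(2)[of c0] bnd(2)[of a0] bnd(3)[of a0] bnd(3)[of b0] bnd(4)[of a0] ord
    by auto
  have proper: "a \<union> b \<subset> a \<union> b \<union> c \<union> d" "c \<union> d \<subset> a \<union> b \<union> c \<union> d"
    "a \<union> c \<subset> a \<union> b \<union> c \<union> d" "b \<union> d \<subset> a \<union> b \<union> c \<union> d"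
    using mem(1,3,5) nin by blast+
  define FX FY F1 F2 where Fs: "FX = K (v ` (a \<union> b))" "FY = K (v ` (c \<union> d))"
    "F1 = K (v ` (a \<union> c))" "F2 = K (v ` (b \<union> d))"
  have csp: "csp (v ` (a \<union> b)) FX" "csp (v ` (c \<union> d)) FY" "csp (v ` (a \<union> c)) F1" "csp (v ` (b \<union> d)) F2"
    using proper[THEN psub] ne unfolding Fs by (auto intro!: K_csp)
  have light: "glen len F1 \<le> t" "glen len F2 \<le> t"
    using proper[THEN psub] ne unfolding Fs by (auto intro!: K_light)
  have Asub: "A \<subseteq> v ` (a \<union> b) \<union> v ` (c \<union> d)" unfolding A by blast
  have XY: "\<not> t < glen len FX + glen len FY" using par q unfolding Fs by simp
  \<comment> \<open>The connection of \<open>a\<close> and \<open>b\<close> cannot go the other way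
    round, where it would touch the terminal at \<open>c0\<close>.\<close>
  have hX: "pos b1 - pos a0 \<le> glen len FX"
  proof (rule csp_arc_len[OF csp(1), of a0 b1])
    assume "e ` ({..<a0} \<union> {b1..<n}) \<subseteq> FX"
    then have "e c0 \<in> FX" using ord by auto
    then have False using heavy_touch[OF csp(1,2) Asub, of c0] XY mem ord by auto
    then show ?thesis ..
  qed (use mem ord in auto)
  have hY: "pos d1 - pos c0 \<le> glen len FY"
  proof (rule csp_arc_len[OF csp(2), of c0 d1])
    assume "e ` ({..<c0} \<union> {d1..<n}) \<subseteq> FY"
    then have "e a0 \<in> FY" using ord by auto
    then have False using heavy_touch[OF csp(2,1) _, of a0] Asub XY mem ord by auto
    then show ?thesis ..
  qed (use mem ord in auto)
  \<comment> \<open>The alternatives are the arc from \<open>a0\<close> to \<open>c1\<close>, and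
    the cycle without the stretch from \<open>a1\<close> to \<open>c0\<close>. If \<open>F1\<close>
    were shorter than both, it would contain the two complementary arcs, which touch all of
    \<open>b\<close> and \<open>d\<close>, and so connect \<open>A\<close>.\<close>
  have f1: "pos c1 - pos a0 \<le> glen len F1 \<or> pos n - (pos c0 - pos a1) \<le> glen len F1"
  proof (rule ccontr)
    assume neg: "\<not> ?thesis"
    have 1: "e ` ({..<a0} \<union> {c1..<n}) \<subseteq> F1"
      by (rule csp_arc_len[OF csp(3), of a0 c1]) (use mem ord neg in auto)
    have 2: "e ` {a1..<c0} \<subseteq> F1"
      by (rule csp_arc_len[OF csp(3), of a1 c0]) (use mem ord neg in auto)
    have "t < glen len F1"
    proof (rule heavy_incident[OF csp(3)])
      fix x assume "x \<in> A - v ` (a \<union> c)"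
      then obtain i where i: "x = v i" "i \<in> b \<union> d" unfolding A by blast
      have "i < n" "i \<in> {..<a0} \<union> {c1..<n} \<union> {a1..<c0}" using i bnd[of i] ord by auto
      then show "\<exists>i<n. e i \<in> F1 \<and> x = v i" using i 1 2 by blast
    qed
    then show False using light by simp
  qed
  have f2: "pos d1 - pos b0 \<le> glen len F2 \<or> pos n - (pos d0 - pos b1) \<le> glen len F2"
  proof (rule ccontr)
    assume neg: "\<not> ?thesis"
    have 1: "e ` ({..<b0} \<union> {d1..<n}) \<subseteq> F2"
      by (rule csp_arc_len[OF csp(4), of b0 d1]) (use mem ord neg in auto)
    have 2: "e ` {b1..<d0} \<subseteq> F2"
      by (rule csp_arc_len[OF csp(4), of b1 d0]) (use mem ord neg in auto)
    have "t < glen len F2"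
    proof (rule heavy_incident[OF csp(4)])
      fix x assume "x \<in> A - v ` (b \<union> d)"
      then obtain i where i: "x = v i" "i \<in> a \<union> c" unfolding A by blast
      have "i < n" "i \<in> {..<b0} \<union> {d1..<n} \<union> {b1..<d0}" using i bnd[of i] ord by auto
      then show "\<exists>i<n. e i \<in> F2 \<and> x = v i" using i 1 2 by blast
    qed
    then show False using light by simp
  qed
  \<comment> \<open>This is where three terminals on each side are needed: a middle one can be dropped, so the
    arc spanned by the side is longer than any gap between consecutive terminals.\<close>
  have remove: "pos n - (pos r - pos p) \<le> t"
    if p: "p \<in> a \<union> b \<union> c \<union> d" "r \<in> a \<union> b \<union> c \<union> d" "x \<in> a \<union> b \<union> c \<union> d" "p < x" "x < r" for p r x
  proof -
    let ?B = "v ` (a \<union> b \<union> c \<union> d - {x})"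
    have "a \<union> b \<union> c \<union> d - {x} \<subset> a \<union> b \<union> c \<union> d" using p(3) by blast
    then have B1: "?B \<subset> A" by (rule psub)
    have pr: "p \<in> a \<union> b \<union> c \<union> d - {x}" "r \<in> a \<union> b \<union> c \<union> d - {x}"
      using p by simp_all
    then have B2: "?B \<noteq> {}" by blast
    note B = B1 B2
    have r: "r < n" using p sub by blast
    show ?thesis
    proof (rule csp_arc_len[OF K_csp[OF B], of p r])
      assume "e ` {p..<r} \<subseteq> K ?B"
      then have ex: "e x \<in> K ?B" using p by auto
      have "t < glen len (K ?B)"
      proof (rule heavy_incident[OF K_csp[OF B]])
        fix z assume "z \<in> A - ?B"
        then have "z = v x" unfolding A by blast
        then show "\<exists>i<n. e i \<in> K ?B \<and> z = v i" using ex p(4,5) r by (intro exI[of _ x]) simp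
      qed
      then show ?thesis using K_light[OF B] by simp
    next
      assume "pos n - (pos r - pos p) \<le> glen len (K ?B)"
      then show ?thesis using K_light[OF B] by simp
    next
      show "v p \<in> ?B" "v r \<in> ?B" by (rule imageI[OF pr(1)], rule imageI[OF pr(2)])
      show "p \<le> r" "r < n" using p(4,5) r by simp_all
    qed
  qed
  have "\<not> a \<union> b \<subseteq> {a0, b1}"
    using card_mono[of "{a0, b1}" "a \<union> b"] cab by (auto simp: card_insert_if split: if_splits)
  then obtain x where x: "x \<in> a \<union> b" "x \<noteq> a0" "x \<noteq> b1" by blast
  then have x': "a0 < x" "x < b1" using bnd[of x] ord by auto
  have rX: "pos n - (pos b1 - pos a0) \<le> t"
    by (rule remove[of a0 b1 x]) (use x x' mem in auto)
  have "\<not> c \<union> d \<subseteq> {c0, d1}"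
    using card_mono[of "{c0, d1}" "c \<union> d"] ccd by (auto simp: card_insert_if split: if_splits)
  then obtain y where y: "y \<in> c \<union> d" "y \<noteq> c0" "y \<noteq> d1" by blast
  then have y': "c0 < y" "y < d1" using bnd[of y] ord by auto
  have rY: "pos n - (pos d1 - pos c0) \<le> t"
    by (rule remove[of c0 d1 y]) (use y y' mem in auto)
  \<comment> \<open>Omitting any one of the four gaps between consecutive blocks leaves an arc that
    contains \<open>A\<close> and is therefore longer than \<open>t\<close>; \<open>in1\<close> and
    \<open>o\<close> record this.\<close>
  have in1: "t < pos d1 - pos a0"
  proof (rule heavy_inner)
    show "A \<subseteq> v ` {a0..d1}" unfolding A
    proof (rule image_mono, rule subsetI)
      fix i assume "i \<in> a \<union> b \<union> c \<union> d"
      then show "i \<in> {a0..d1}" using bnd[of i] ord by auto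
    qed
  qed (use ord in auto)
  have out: "t < pos n - (pos r - pos p)"
    if "(p, r) \<in> {(a1, b0), (b1, c0), (c1, d0)}" for p r
  proof (rule heavy_outer)
    have "i \<in> {..p} \<union> {r..<n}" if "i \<in> a \<union> b \<union> c \<union> d" for i
      using that \<open>(p, r) \<in> _\<close> bnd[of i] ord by auto
    then have "a \<union> b \<union> c \<union> d \<subseteq> {..p} \<union> {r..<n}" by blast
    then show "A \<subseteq> v ` ({..p} \<union> {r..<n})" unfolding A by (rule image_mono)
  qed (use that ord in auto)
  have o: "t < pos n - (pos b0 - pos a1)" "t < pos n - (pos c0 - pos b1)" "t < pos n - (pos d0 - pos c1)"
    by (rule out; simp)+
  have m: "pos a0 \<le> pos a1" "pos b0 \<le> pos b1" "pos c0 \<le> pos c1" "pos d0 \<le> pos d1"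
    using ord by (auto intro!: pos_mono)
  have total: "glen len FX + glen len FY + glen len F1 + glen len F2 \<le> 2 * t"
    using par crs unfolding Fs by simp
  \<comment> \<open>If \<open>f1\<close> and \<open>f2\<close> both hold by their first or both by
    their second alternatives, the four lengths count at least twice an arc that omits a single gap.
    In the mixed cases the arc of one side is counted three times; by \<open>rX\<close> or
    \<open>rY\<close> the third copy outweighs the gap between \<open>b\<close> and
    \<open>c\<close>, which again yields two arcs each omitting one gap.\<close>
  show False
    using f1 f2 hX hY rX rY in1 o m total by (elim disjE) linarith+
qed

text \<open>A part interleaved with its partner, together with a terminal of the opposite side,
  would cross its complement, contrary to \<open>no_cross\<close>. So the parts are consecutive
  blocks. Both crossing pairings are assumed because the order within each side is not known in
  advance.\<close>

lemma linear_quartet_false: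
  assumes A: "A = X1 \<union> X2 \<union> Y1 \<union> Y2"
    and disj: "X1 \<inter> X2 = {}" "Y1 \<inter> Y2 = {}" "(X1 \<union> X2) \<inter> (Y1 \<union> Y2) = {}"
    and ne: "X1 \<noteq> {}" "X2 \<noteq> {}" "Y1 \<noteq> {}" "Y2 \<noteq> {}"
    and card: "3 \<le> card (X1 \<union> X2)" "3 \<le> card (Y1 \<union> Y2)"
    and q: "0 \<le> q"
    and par: "glen len (K (X1 \<union> X2)) + glen len (K (Y1 \<union> Y2)) + q \<le> t"
    and crs: "glen len (K (X1 \<union> Y1)) + glen len (K (X2 \<union> Y2)) \<le> t + q"
    "glen len (K (X1 \<union> Y2)) + glen len (K (X2 \<union> Y1)) \<le> t + q"
    and one: "\<And>Z. Z \<in> {X1, X2, Y1, Y2} \<Longrightarrow> glen len (K Z) + glen len (K (A - Z)) \<le> t"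
    and lin: "\<And>i j. i < n \<Longrightarrow> j < n \<Longrightarrow> v i \<in> X1 \<union> X2 \<Longrightarrow> v j \<in> Y1 \<union> Y2 \<Longrightarrow> i < j"
  shows False
proof -
  define idx where "idx S = {i. i < n \<and> v i \<in> S}" for S
  have v_idx: "v ` idx S = S" if "S \<subseteq> A" for S
    using that A_sub unfolding idx_def by auto
  have idx_Un: "idx (S \<union> T) = idx S \<union> idx T" for S T unfolding idx_def by auto
  have subs: "X1 \<subseteq> A" "X2 \<subseteq> A" "Y1 \<subseteq> A" "Y2 \<subseteq> A" using A by auto
  have ne': "idx X1 \<noteq> {}" "idx X2 \<noteq> {}" "idx Y1 \<noteq> {}" "idx Y2 \<noteq> {}"
    using v_idx[OF subs(1)] v_idx[OF subs(2)] v_idx[OF subs(3)] v_idx[OF subs(4)] ne by auto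
  have card_idx: "card (idx S) = card S" if "S \<subseteq> A" for S
  proof -
    have "idx S \<subseteq> {..<n}" by (auto simp: idx_def)
    from card_image[OF inj_on_subset[OF inj_v this]] show ?thesis using v_idx[OF that] by simp
  qed
  \<comment> \<open>Two disjoint index sets neither of which precedes the other contain three
    indices alternating between them, and \<open>nc\<close> rules these out.\<close>
  have sep: "(\<forall>i\<in>idx P. \<forall>j\<in>idx Q. i < j) \<or> (\<forall>i\<in>idx Q. \<forall>j\<in>idx P. i < j)"
    if PQ: "{P, Q} = {X1, X2} \<or> {P, Q} = {Y1, Y2}" "P \<inter> Q = {}"
      and nc: "\<And>Z i j k. Z \<in> {P, Q} \<Longrightarrow> i < j \<Longrightarrow> j < k \<Longrightarrow> k < n \<Longrightarrow> v i \<in> Z \<Longrightarrow> v j \<in> A - Z \<Longrightarrow> v k \<in> Z \<Longrightarrow> False"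
    for P Q
  proof (rule ccontr)
    assume "\<not> ?thesis"
    then obtain i1 j1 i2 j2 where ij: "i1 \<in> idx P" "j1 \<in> idx Q" "\<not> i1 < j1" "i2 \<in> idx P" "j2 \<in> idx Q" "\<not> j2 < i2"
      by blast
    have "i \<noteq> j" if "i \<in> idx P" "j \<in> idx Q" for i j using that PQ(2) unfolding idx_def by auto
    with ij have lt: "j1 < i1" "i2 < j2" "i1 \<noteq> j2" by (metis linorder_neqE_nat)+
    have mem: "v i1 \<in> P" "v i2 \<in> P" "v j1 \<in> Q" "v j2 \<in> Q" "i1 < n" "j2 < n"
      using ij unfolding idx_def by auto
    have PQA: "P \<subseteq> A - Q" "Q \<subseteq> A - P" using PQ subs disj by (auto simp: doubleton_eq_iff)
    show False
    proof (cases "i1 < j2")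
      case True
      then show False using nc[of Q j1 i1 j2] lt mem PQA by blast
    next
      case False
      then have "j2 < i1" using lt by simp
      then show False using nc[of P i2 j2 i1] lt mem PQA by blast
    qed
  qed
  obtain y where y: "y \<in> idx (Y1 \<union> Y2)" using ne' idx_Un by blast
  obtain x where x: "x \<in> idx (X1 \<union> X2)" using ne' idx_Un by blast
  have lin': "i < j" if "i \<in> idx (X1 \<union> X2)" "j \<in> idx (Y1 \<union> Y2)" for i j
    using that lin unfolding idx_def by blast
  have sepX: "(\<forall>i\<in>idx X1. \<forall>j\<in>idx X2. i < j) \<or> (\<forall>i\<in>idx X2. \<forall>j\<in>idx X1. i < j)"
  proof (rule sep)
    fix Z i j k assume Z: "Z \<in> {X1, X2}" "i < j" "j < k" "k < n" "v i \<in> Z" "v j \<in> A - Z" "v k \<in> Z"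
    have "k < y" using Z y by (intro lin') (auto simp: idx_def)
    moreover have "v y \<in> A - Z" "y < n" using y Z disj A by (auto simp: idx_def)
    moreover have "Z \<union> (A - Z) = A" using Z subs by auto
    ultimately show False using no_cross[of Z "A - Z" i j k y] one[of Z] Z by blast
  qed (use disj in auto)
  have sepY: "(\<forall>i\<in>idx Y1. \<forall>j\<in>idx Y2. i < j) \<or> (\<forall>i\<in>idx Y2. \<forall>j\<in>idx Y1. i < j)"
  proof (rule sep)
    fix Z i j k assume Z: "Z \<in> {Y1, Y2}" "i < j" "j < k" "k < n" "v i \<in> Z" "v j \<in> A - Z" "v k \<in> Z"
    have "x < i" using Z x by (intro lin') (auto simp: idx_def)
    moreover have "v x \<in> A - Z" using x Z disj A by (auto simp: idx_def)
    moreover have "(A - Z) \<union> Z = A" using Z subs by auto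
    moreover have "glen len (K (A - Z)) + glen len (K Z) \<le> t" using one[of Z] Z by (auto simp: add.commute)
    ultimately show False using no_cross[of "A - Z" Z x i j k] Z by blast
  qed (use disj in auto)
  have final: False if "{P, P'} = {X1, X2}" "{Q, Q'} = {Y1, Y2}"
    and P: "\<forall>i\<in>idx P. \<forall>j\<in>idx P'. i < j" and Q: "\<forall>i\<in>idx Q. \<forall>j\<in>idx Q'. i < j" for P P' Q Q'
  proof -
    have un: "P \<union> P' = X1 \<union> X2" "Q \<union> Q' = Y1 \<union> Y2"
      using that(1,2) by (auto simp: doubleton_eq_iff)
    have nemp: "idx P \<noteq> {}" "idx P' \<noteq> {}" "idx Q \<noteq> {}" "idx Q' \<noteq> {}"
      using that(1,2) ne' by (auto simp: doubleton_eq_iff)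
    have sb: "P \<subseteq> A" "P' \<subseteq> A" "Q \<subseteq> A" "Q' \<subseteq> A" using that(1,2) subs by (auto simp: doubleton_eq_iff)
    have vi: "v ` (idx S \<union> idx T) = S \<union> T" if "S \<subseteq> A" "T \<subseteq> A" for S T
      using that v_idx by (simp add: image_Un)
    have c: "glen len (K (P \<union> Q)) + glen len (K (P' \<union> Q')) \<le> t + q"
      using that(1,2) crs by (auto simp: doubleton_eq_iff add.commute)
    have "P \<union> P' \<union> Q \<union> Q' = A" using un A by (metis Un_assoc)
    then have AA: "A = v ` (idx P \<union> idx P' \<union> idx Q \<union> idx Q')"
      using sb by (simp add: image_Un v_idx)
    show False
    proof (rule ordered_quartet_false[of "idx P" "idx P'" "idx Q" "idx Q'" q, OF _ nemp _ _ _ AA _ _ q])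
      show "idx P \<union> idx P' \<union> idx Q \<union> idx Q' \<subseteq> {..<n}" by (auto simp: idx_def)
      show "3 \<le> card (idx P \<union> idx P')" "3 \<le> card (idx Q \<union> idx Q')"
        unfolding idx_Un[symmetric] using card_idx[of "X1 \<union> X2"] card_idx[of "Y1 \<union> Y2"] card un subs by simp_all
      show "i < j" if "i \<in> idx P'" "j \<in> idx Q" for i j
      proof (rule lin')
        show "i \<in> idx (X1 \<union> X2)" using that un(1) by (auto simp: idx_def)
        show "j \<in> idx (Y1 \<union> Y2)" using that un(2) by (auto simp: idx_def)
      qed
      show "glen len (K (v ` (idx P \<union> idx P'))) + glen len (K (v ` (idx Q \<union> idx Q'))) + q \<le> t"
        using par un sb by (simp add: vi)
      show "glen len (K (v ` (idx P \<union> idx Q))) + glen len (K (v ` (idx P' \<union> idx Q'))) \<le> t + q"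
        using c sb by (simp add: vi)
    qed (use P Q in blast)+
  qed
  show False
    using sepX sepY
    by (elim disjE) (rule final; (assumption | rule refl | rule insert_commute))+
qed

lemma rotate_shortcut:
  assumes "k < n"
  shows "shortcut_cycle ends (\<lambda>i. v ((i + k) mod n)) (\<lambda>i. e ((i + k) mod n)) n len A t K"
proof -
  interpret R: cycle_graph ends "\<lambda>i. v ((i + k) mod n)" "\<lambda>i. e ((i + k) mod n)" n
    using assms by (rule rotate(1))
  show ?thesis
    by unfold_locales (use rotate(2,3)[OF assms] len_nonneg A_sub heavy K_csp K_light n in auto)
qed

text \<open>Two rotations turn the cyclic order into a linear one. The first puts a Y terminal at
  position \<open>0\<close>; the second starts at the first X terminal after it. The new numbering
  then ends with a stretch free of X that begins at position \<open>n - l\<close> with that Y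
  terminal.\<close>

lemma quartet_false:
  assumes A: "A = X1 \<union> X2 \<union> Y1 \<union> Y2"
    and disj: "X1 \<inter> X2 = {}" "Y1 \<inter> Y2 = {}" "(X1 \<union> X2) \<inter> (Y1 \<union> Y2) = {}"
    and ne: "X1 \<noteq> {}" "X2 \<noteq> {}" "Y1 \<noteq> {}" "Y2 \<noteq> {}"
    and card: "3 \<le> card (X1 \<union> X2)" "3 \<le> card (Y1 \<union> Y2)"
    and q: "0 \<le> q"
    and par: "glen len (K (X1 \<union> X2)) + glen len (K (Y1 \<union> Y2)) + q \<le> t"
    and crs: "glen len (K (X1 \<union> Y1)) + glen len (K (X2 \<union> Y2)) \<le> t + q"
    "glen len (K (X1 \<union> Y2)) + glen len (K (X2 \<union> Y1)) \<le> t + q"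
    and one: "\<And>Z. Z \<in> {X1, X2, Y1, Y2} \<Longrightarrow> glen len (K Z) + glen len (K (A - Z)) \<le> t"
  shows False
proof -
  have "Y1 \<union> Y2 \<noteq> {}" "X1 \<union> X2 \<noteq> {}" using ne by auto
  then obtain k m where k: "k < n" "v k \<in> Y1 \<union> Y2" and m: "m < n" "v m \<in> X1 \<union> X2"
    using A_sub unfolding A by blast
  define w where "w = (\<lambda>i. v ((i + k) mod n))"
  define f where "f = (\<lambda>i. e ((i + k) mod n))"
  interpret R: shortcut_cycle ends w f n len A t K
    unfolding w_def f_def using k(1) by (rule rotate_shortcut)
  have w0: "w 0 \<in> Y1 \<union> Y2" using k by (simp add: w_def)
  have "v m \<in> w ` {..<n}" using rotate(2)[OF k(1)] m unfolding w_def by auto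
  then have ex: "\<exists>i. i < n \<and> w i \<in> X1 \<union> X2" using m by auto
  define l where "l = (LEAST i. i < n \<and> w i \<in> X1 \<union> X2)"
  have l: "l < n" "w l \<in> X1 \<union> X2" using LeastI_ex[OF ex] unfolding l_def by auto
  have l_least: "l \<le> i" if "i < n" "w i \<in> X1 \<union> X2" for i
    unfolding l_def using that by (intro Least_le) auto
  have "l \<noteq> 0" using w0 l disj(3) by (metis IntI empty_iff)
  define u where "u = (\<lambda>i. w ((i + l) mod n))"
  define g where "g = (\<lambda>i. f ((i + l) mod n))"
  interpret S: shortcut_cycle ends u g n len A t K
    unfolding u_def g_def using l(1) by (rule R.rotate_shortcut)
  have u0: "u 0 \<in> X1 \<union> X2" "u (n - l) \<in> Y1 \<union> Y2" using l w0 by (simp_all add: u_def)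
  have XY: "(X1 \<union> X2) \<union> (Y1 \<union> Y2) = A" using A by auto
  have pq: "glen len (K (X1 \<union> X2)) + glen len (K (Y1 \<union> Y2)) \<le> t" using par q by simp
  show False
  proof (rule S.linear_quartet_false[OF A disj ne card q par crs one])
    fix i j assume ij: "i < n" "j < n" "u i \<in> X1 \<union> X2" "u j \<in> Y1 \<union> Y2"
    show "i < j"
    proof (rule ccontr)
      assume "\<not> i < j"
      moreover have "i \<noteq> j" using ij disj(3) by blast
      ultimately have "j < i" by simp
      have "j \<noteq> 0" using ij u0 disj(3) by (metis IntI empty_iff)
      have "i < n - l"
      proof (rule ccontr)
        assume *: "\<not> i < n - l"
        then have "(i + l) mod n = i + l - n" using ij l by (simp add: le_mod_geq)
        then have "l \<le> i + l - n" using l_least[of "i + l - n"] ij l unfolding u_def by simp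
        then show False using ij * l by linarith
      qed
      \<comment> \<open>The positions \<open>0\<close>, \<open>j\<close>, \<open>i\<close>,
        \<open>n - l\<close> now alternate between the X and Y sides.\<close>
      then show False
        using S.no_cross[OF XY disj(3) pq, of 0 j i "n - l"] u0 ij \<open>j < i\<close> \<open>j \<noteq> 0\<close> \<open>l \<noteq> 0\<close> by auto
    qed
  qed auto
qed

end

section \<open>Steiner distance\<close>

lemma steiner_dist_spans:
  "steiner_dist ends len V E A = Inf {ereal (glen len F) |F. spans ends V E A F}"
  unfolding steiner_dist_def spans_def by (rule arg_cong[where f = Inf]) blast

lemma steiner_dist_attained:
  assumes "finite E" "spans ends V E A F0"
  obtains F where "spans ends V E A F" "steiner_dist ends len V E A = ereal (glen len F)"
    "\<And>F'. spans ends V E A F' \<Longrightarrow> glen len F \<le> glen len F'"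
proof -
  let ?S = "{F. spans ends V E A F}"
  have "?S \<subseteq> Pow E" using spans_imp_subset by fast
  then have fin: "finite ?S" using assms(1) finite_subset by auto
  have ne: "?S \<noteq> {}" using assms(2) by blast
  define m where "m = Min (glen len ` ?S)"
  have "m \<in> glen len ` ?S" unfolding m_def using fin ne by (intro Min_in) auto
  then obtain F where F: "spans ends V E A F" "m = glen len F" by blast
  have le: "glen len F \<le> glen len F'" if "spans ends V E A F'" for F'
    using that fin F(2) unfolding m_def by (metis Min_le finite_imageI image_eqI mem_Collect_eq)
  have "steiner_dist ends len V E A = ereal (glen len F)"
    unfolding steiner_dist_spans
    by (rule antisym[OF Inf_lower Inf_greatest]) (use F le in auto)
  then show thesis using that[OF F(1)] le by blast
qed

text \<open>Replaces extended reals by a comparison of edge sets. A connection in the subgraph is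
  one in the graph, so only the inequality in the other direction has content.\<close>

lemma steiner_dist_eq_iff:
  assumes "finite E" "subgraph V' E' V E ends" "spans ends V' E' A F0"
  shows "steiner_dist ends len V' E' A = steiner_dist ends len V E A \<longleftrightarrow>
    (\<exists>F'. spans ends V' E' A F' \<and> (\<forall>F. spans ends V E A F \<longrightarrow> glen len F' \<le> glen len F))"
    (is "?eq \<longleftrightarrow> ?ex")
proof -
  have "finite E'" using assms(1,2) unfolding subgraph_def by (blast intro: finite_subset)
  then obtain F' where F': "spans ends V' E' A F'" "steiner_dist ends len V' E' A = ereal (glen len F')"
    "\<And>F. spans ends V' E' A F \<Longrightarrow> glen len F' \<le> glen len F"
    using steiner_dist_attained[OF _ assms(3)] by metis
  obtain F where F: "spans ends V E A F" "steiner_dist ends len V E A = ereal (glen len F)"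
    "\<And>H. spans ends V E A H \<Longrightarrow> glen len F \<le> glen len H"
    using steiner_dist_attained[OF assms(1) spans_supergraph[OF assms(3,2)]] by metis
  show ?thesis
  proof
    assume ?eq
    then have "glen len F' = glen len F" using F F' by simp
    then show ?ex using F F' by auto
  next
    assume ?ex
    then obtain H where H: "spans ends V' E' A H" "glen len H \<le> glen len F" using F(1) by blast
    have "glen len F' \<le> glen len F" using F'(3)[OF H(1)] H(2) by simp
    moreover have "glen len F \<le> glen len F'" using F(3)[OF spans_supergraph[OF F'(1) assms(2)]] .
    ultimately show ?eq using F F' by simp
  qed
qed

section \<open>Induction on the number of terminals\<close>

lemma is_cycle_cycle_graph:
  assumes "is_cycle ends VC EC"
  obtains v e n where "cycle_graph ends v e n" "VC = v ` {..<n}" "EC = e ` {..<n}"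
proof -
  obtain vs es where c: "length vs \<ge> 2" "length es = length vs" "distinct vs" "distinct es"
    "\<forall>i<length vs. ends (es ! i) = {vs ! i, vs ! ((i + 1) mod length vs)}" "VC = set vs" "EC = set es"
    using assms unfolding is_cycle_def by blast
  have "cycle_graph ends ((!) vs) ((!) es) (length vs)"
    using c by unfold_locales (auto intro!: inj_onI simp: nth_eq_iff_index_eq)
  moreover have "VC = (!) vs ` {..<length vs}" "EC = (!) es ` {..<length vs}"
    using c by (auto simp: set_conv_nth)
  ultimately show thesis using that by blast
qed

lemma cycle_minimiser_step:
  assumes G: "graph V E ends" and pos: "\<forall>e\<in>E. len e > 0"
    and C: "subgraph VC EC V E ends" "is_cycle ends VC EC"
    and A: "A \<subseteq> VC" "7 \<le> card A"
    and IH: "\<And>B. B \<subset> A \<Longrightarrow>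
      \<exists>F'. spans ends VC EC B F' \<and> (\<forall>F. spans ends V E B F \<longrightarrow> glen len F' \<le> glen len F)"
  shows "\<exists>F'. spans ends VC EC A F' \<and> (\<forall>F. spans ends V E A F \<longrightarrow> glen len F' \<le> glen len F)"
proof (rule ccontr)
  assume neg: "\<not> ?thesis"
  have fin: "finite V" "finite E" using G unfolding graph_def by auto
  obtain v e n where cg: "cycle_graph ends v e n" and VC: "VC = v ` {..<n}" and EC: "EC = e ` {..<n}"
    using is_cycle_cycle_graph[OF C(2)] by metis
  interpret cycle_graph ends v e n by (rule cg)
  have ECE: "EC \<subseteq> E" using C(1) unfolding subgraph_def by blast
  have "finite EC" using ECE fin(2) by (rule finite_subset)
  have "spans ends VC EC A EC"
    using A(1) unfolding VC EC by (rule csp_whole)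
  from steiner_dist_attained[OF \<open>finite EC\<close> this]
  obtain F0 where F0: "spans ends VC EC A F0" "\<And>F. spans ends VC EC A F \<Longrightarrow> glen len F0 \<le> glen len F"
    by metis
  obtain F where F: "spans ends V E A F" "glen len F < glen len F0"
    using neg F0(1) by (meson not_le)
  define t where "t = glen len F"
  obtain K where K: "\<And>B. B \<subset> A \<Longrightarrow> spans ends VC EC B (K B)"
    and K_le: "\<And>B F. B \<subset> A \<Longrightarrow> spans ends V E B F \<Longrightarrow> glen len (K B) \<le> glen len F"
    using IH by metis
  have FE: "F \<subseteq> E" using F(1) by (rule spans_imp_subset)
  interpret shortcut_cycle ends v e n len A t K
  proof unfold_locales
    show "0 \<le> len (e i)" if "i < n" for i
      using that ECE pos unfolding EC by (auto intro!: less_imp_le)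
    show "A \<subseteq> v ` {..<n}" using A(1) VC by simp
    show "t < glen len H" if "csp A H" for H
      using F0(2)[of H] that F(2) unfolding VC EC t_def by simp
    show "csp B (K B)" if "B \<subset> A" for B using K[OF that] unfolding VC EC .
    show "glen len (K B) \<le> t" if "B \<subset> A" for B
      unfolding t_def by (rule K_le[OF that spans_mono[OF F(1)]]) (use that in blast)
  qed
  have "finite A" using A(2) by (metis card.infinite not_numeral_le_zero)
  from spans_H_shape[OF fin(1) F(1) this A(2)]
  obtain w z X1 X2 Y1 Y2 S1 S2 P R1 R2 where
    sp: "spans ends V E (insert w X1) S1" "spans ends V E (insert w X2) S2" "spans ends V E {w, z} P"
      "spans ends V E (insert z Y1) R1" "spans ends V E (insert z Y2) R2" and
    dj: "S1 \<inter> S2 = {}" "(S1 \<union> S2) \<inter> P = {}" "R1 \<inter> R2 = {}" "(S1 \<union> S2 \<union> P) \<inter> (R1 \<union> R2) = {}" and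
    subF: "S1 \<union> S2 \<union> P \<union> R1 \<union> R2 \<subseteq> F" and
    AXY: "A = X1 \<union> X2 \<union> Y1 \<union> Y2" "X1 \<inter> X2 = {}" "Y1 \<inter> Y2 = {}" "(X1 \<union> X2) \<inter> (Y1 \<union> Y2) = {}" and
    ne: "X1 \<noteq> {}" "X2 \<noteq> {}" "Y1 \<noteq> {}" "Y2 \<noteq> {}" and
    card: "3 \<le> card (X1 \<union> X2)" "3 \<le> card (Y1 \<union> Y2)" .
  have finF: "finite F" using FE fin(2) by (rule finite_subset)
  have fins: "finite S1" "finite S2" "finite P" "finite R1" "finite R2"
    using subF finite_subset[OF _ finF] by auto
  have len0: "0 \<le> len x" if "x \<in> F" for x using that FE pos by (auto intro: less_imp_le)
  define g where "g = glen len"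
  have gU: "g (H \<union> H') \<le> g H + g H'" if "H \<subseteq> F" "H' \<subseteq> F" for H H'
    unfolding g_def using that finF len0 by (intro glen_union_le) (auto intro: finite_subset)
  \<comment> \<open>Each \<open>K B\<close> below is at most as long as the pieces of the H-shape
    that connect \<open>B\<close>; this sum bounds all the combinations.\<close>
  have total: "g S1 + g S2 + g P + g R1 + g R2 \<le> t"
  proof -
    have "g (S1 \<union> S2 \<union> P \<union> (R1 \<union> R2)) = g S1 + g S2 + g P + (g R1 + g R2)"
      unfolding g_def using fins dj by (simp only: glen_union_disjoint finite_Un)
    moreover have "g (S1 \<union> S2 \<union> P \<union> (R1 \<union> R2)) \<le> t"
      unfolding g_def t_def using subF finF len0 by (intro glen_mono) auto
    ultimately show ?thesis by simp
  qed
  have Fs: "S1 \<subseteq> F" "S2 \<subseteq> F" "P \<subseteq> F" "R1 \<subseteq> F" "R2 \<subseteq> F" using subF by auto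
  have X: "spans ends V E (insert w (X1 \<union> X2)) (S1 \<union> S2)"
    using spans_union[OF sp(1,2), of w] by (simp add: insert_commute)
  have Y: "spans ends V E (insert z (Y1 \<union> Y2)) (R1 \<union> R2)"
    using spans_union[OF sp(4,5), of z] by (simp add: insert_commute)
  have thru: "spans ends V E (S \<union> T) (H \<union> P \<union> H')"
    if "spans ends V E (insert w S) H" "spans ends V E (insert z T) H'" for S T H H'
  proof -
    have "spans ends V E (insert w S \<union> {w, z}) (H \<union> P)"
      using spans_union[OF that(1) sp(3), of w] by simp
    from spans_union[OF this that(2), of z]
    have "spans ends V E (insert w S \<union> {w, z} \<union> insert z T) (H \<union> P \<union> H')" by simp
    then show ?thesis by (rule spans_mono) blast
  qed
  have thru_le: "g (H \<union> P \<union> H') \<le> g H + g P + g H'" if "H \<subseteq> F" "H' \<subseteq> F" for H H'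
    using gU[of "H \<union> P" H'] gU[of H P] that Fs by simp
  have k: "g (K B) \<le> r" if "B \<subset> A" "spans ends V E B H" "g H \<le> r" for B H r
    using K_le[OF that(1,2)] that(3) unfolding g_def by simp
  obtain x1 x2 y1 y2 where el: "x1 \<in> X1" "x2 \<in> X2" "y1 \<in> Y1" "y2 \<in> Y2" using ne by blast
  then have nin: "x1 \<notin> X2 \<union> Y1 \<union> Y2" "x2 \<notin> X1 \<union> Y1 \<union> Y2" "y1 \<notin> X1 \<union> X2 \<union> Y2" "y2 \<notin> X1 \<union> X2 \<union> Y1"
    using AXY(2-4) by auto
  have proper: "X1 \<subset> A" "X2 \<subset> A" "Y1 \<subset> A" "Y2 \<subset> A" "X1 \<union> X2 \<subset> A" "Y1 \<union> Y2 \<subset> A"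
    "X1 \<union> Y1 \<subset> A" "X2 \<union> Y2 \<subset> A" "X1 \<union> Y2 \<subset> A" "X2 \<union> Y1 \<subset> A"
    "X2 \<union> (Y1 \<union> Y2) \<subset> A" "X1 \<union> (Y1 \<union> Y2) \<subset> A" "X1 \<union> X2 \<union> Y2 \<subset> A" "X1 \<union> X2 \<union> Y1 \<subset> A"
    unfolding AXY(1) using el nin by blast+
  have kX: "g (K (X1 \<union> X2)) \<le> g S1 + g S2" "g (K (Y1 \<union> Y2)) \<le> g R1 + g R2"
    using k[OF proper(5) spans_mono[OF X]] k[OF proper(6) spans_mono[OF Y]] gU Fs by auto
  have k1: "g (K X1) \<le> g S1" "g (K X2) \<le> g S2" "g (K Y1) \<le> g R1" "g (K Y2) \<le> g R2"
    using k[OF proper(1) spans_mono[OF sp(1)]] k[OF proper(2) spans_mono[OF sp(2)]]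
      k[OF proper(3) spans_mono[OF sp(4)]] k[OF proper(4) spans_mono[OF sp(5)]] by auto
  \<comment> \<open>Both connections of a crossing pair run through \<open>P\<close>, so together
    they exceed \<open>t\<close> by at most \<open>g P\<close>.\<close>
  have kc: "g (K (X1 \<union> Y1)) \<le> g S1 + g P + g R1" "g (K (X2 \<union> Y2)) \<le> g S2 + g P + g R2"
    "g (K (X1 \<union> Y2)) \<le> g S1 + g P + g R2" "g (K (X2 \<union> Y1)) \<le> g S2 + g P + g R1"
    by (rule k[OF proper(7) thru[OF sp(1,4)]] k[OF proper(8) thru[OF sp(2,5)]]
        k[OF proper(9) thru[OF sp(1,5)]] k[OF proper(10) thru[OF sp(2,4)]]; rule thru_le; fact)+
  \<comment> \<open>The complement of a single part uses the remaining pieces including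
    \<open>P\<close>, so a part and its complement together fit into \<open>t\<close>.\<close>
  have kr: "g (K (X2 \<union> (Y1 \<union> Y2))) \<le> g S2 + g P + (g R1 + g R2)"
    "g (K (X1 \<union> (Y1 \<union> Y2))) \<le> g S1 + g P + (g R1 + g R2)"
    "g (K (X1 \<union> X2 \<union> Y2)) \<le> g S1 + g S2 + g P + g R2"
    "g (K (X1 \<union> X2 \<union> Y1)) \<le> g S1 + g S2 + g P + g R1"
    using k[OF proper(11) thru[OF sp(2) Y]] k[OF proper(12) thru[OF sp(1) Y]]
      k[OF proper(13) thru[OF X sp(5)]] k[OF proper(14) thru[OF X sp(4)]]
      thru_le[of S2 "R1 \<union> R2"] thru_le[of S1 "R1 \<union> R2"] thru_le[of "S1 \<union> S2" R2] thru_le[of "S1 \<union> S2" R1]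
      gU[OF Fs(1,2)] gU[OF Fs(4,5)] Fs by auto
  have diff: "A - X1 = X2 \<union> (Y1 \<union> Y2)" "A - X2 = X1 \<union> (Y1 \<union> Y2)"
    "A - Y1 = X1 \<union> X2 \<union> Y2" "A - Y2 = X1 \<union> X2 \<union> Y1"
    using AXY by blast+
  show False
  proof (rule quartet_false[OF AXY ne card, of "g P"])
    show "0 \<le> g P" unfolding g_def using Fs(3) len0 by (intro glen_nonneg) auto
    show "glen len (K Z) + glen len (K (A - Z)) \<le> t" if "Z \<in> {X1, X2, Y1, Y2}" for Z
      using that kr k1 total unfolding g_def[symmetric] by (auto simp: diff)
  qed (use kX kc total in \<open>simp_all add: g_def[symmetric]\<close>)
qed

theorem theorem2:
  fixes V :: "'v set" and E :: "'e set" and ends :: "'e \<Rightarrow> 'v set" and len :: "'e \<Rightarrow> real"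
    and VC :: "'v set" and EC :: "'e set"
  assumes "graph V E ends"
    and "\<forall>e\<in>E. len e > 0"
    and "subgraph VC EC V E ends"
    and "is_cycle ends VC EC"
    and "k_geodesic 6 ends len VC EC V E"
  shows "fully_geodesic ends len VC EC V E"
proof -
  have finE: "finite E" "finite V" using assms(1) unfolding graph_def by auto
  obtain v e n where cg: "cycle_graph ends v e n" and VC: "VC = v ` {..<n}" and EC: "EC = e ` {..<n}"
    using is_cycle_cycle_graph[OF assms(4)] by metis
  interpret cycle_graph ends v e n by (rule cg)
  have whole: "spans ends VC EC A EC" if "A \<subseteq> VC" for A
    using that unfolding VC EC by (rule csp_whole)
  note eq_iff = steiner_dist_eq_iff[OF finE(1) assms(3) whole]
  have "steiner_dist ends len VC EC A = steiner_dist ends len V E A" if "A \<subseteq> VC" for A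
    using that
  \<comment> \<open>Strong induction makes every proper subset of \<open>A\<close> optimally
    connected inside the cycle, as the step for more than six terminals requires.\<close>
  proof (induction "card A" arbitrary: A rule: less_induct)
    case less
    show ?case
    proof (cases "card A \<le> 6")
      case True
      then show ?thesis using assms(5) less.prems unfolding k_geodesic_def by blast
    next
      case False
      have "finite A" using less.prems VC finite_subset by blast
      have "\<exists>F'. spans ends VC EC B F' \<and> (\<forall>F. spans ends V E B F \<longrightarrow> glen len F' \<le> glen len F)"
        if "B \<subset> A" for B
      proof -
        have "B \<subseteq> VC" using that less.prems by blast
        moreover have "card B < card A" using \<open>finite A\<close> that by (rule psubset_card_mono)
        ultimately show ?thesis using less.hyps eq_iff by blast
      qed
      then show ?thesis
        unfolding eq_iff[OF less.prems]
        using False cycle_minimiser_step[OF assms(1-4) less.prems] by simp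
    qed
  qed
  then show ?thesis unfolding fully_geodesic_def k_geodesic_def by blast
qed

end
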